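(* Let $a\in\mathbb{R}$, $b\in[0,1]$, let $N$ be a positive integer written as $N=2M+1$ or $N=2M$ with $M$ an integer, and let $f:K^-_{[a,a+1]}\to\mathbb{C}$ be a function. Then there exists a unique antisymmetric interpolating function for $f$, that is, a unique function of the form $$\psi^-_N(x,y)=\sum_{\substack{k,l=-M\\ k>l}}^{M} c^-_{kl}\,E^-_{(k,l)}(x,y),\qquad x,y\in\mathbb{R},$$ with coefficients $c^-_{kl}\in\mathbb{C}$ which, in the case $N=2M$, are assumed to satisfy the additional $2M$ conditions $$c^-_{l,-M}=-\tau_N\,c^-_{M,l}\quad (l=-M+1,\dots,M-1),\qquad c^-_{M,-M}=0,$$ such that $$\psi^-_N(x_m,y_n)=f(x_m,y_n)\quad\text{for all } m,n\in\{0,\dots,N-1\},\ m>n.$$ Its coefficients ($k,l\in\{-M,\dots,M\}$, $k>l$) are given for $N=2M+1$ by $$c^-_{kl}=\frac{1}{N^2}\sum_{\substack{m,n=0\\ m>n}}^{N-1}f(x_m,y_n)\,\overline{E^-_{(k,l)}(x_m,y_n)},$$ and for $N=2M$ by $$c^-_{kl}=\frac{g_{k,M}\,g_{l,M}}{N^2}\sum_{\substack{m,n=0\\ m>n}}^{N-1}f(x_m,y_n)\,\overline{E^-_{(k,l)}(x_m,y_n)}.$$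
   Context: For $k,l\in\mathbb{Z}$ and $x,y\in\mathbb{R}$, the antisymmetric exponential function is $E^-_{(k,l)}(x,y)=e^{2\pi i(kx+ly)}-e^{2\pi i(ky+lx)}$. The triangle is $K^-_{[a,a+1]}=\{(x,y)\in[a,a+1]\times[a,a+1] : x>y\}$. The grid points are $(x_m,y_n)=\left(a+\frac{m+b}{N},\,a+\frac{n+b}{N}\right)$ for $m,n\in\{0,\dots,N-1\}$. Put $\tau_N=e^{2\pi i(Na+b)}$, and let $g_{k,M}=\tfrac12$ if $k=-M$ or $k=M$, and $g_{k,M}=1$ otherwise. *)

theory Defs
  imports "HOL-Analysis.Analysis"
begin

definition anti_exp :: "int \<Rightarrow> int \<Rightarrow> real \<times> real \<Rightarrow> complex" where
  "anti_exp k l = (\<lambda>(x, y).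
     exp (2 * complex_of_real pi * \<i> * complex_of_real (of_int k * x + of_int l * y)) -
     exp (2 * complex_of_real pi * \<i> * complex_of_real (of_int k * y + of_int l * x)))"

definition anti_triangle :: "real \<Rightarrow> (real \<times> real) set" where
  "anti_triangle a = {(x, y). x \<in> {a..a + 1} \<and> y \<in> {a..a + 1} \<and> x > y}"

definition grid_point :: "real \<Rightarrow> real \<Rightarrow> nat \<Rightarrow> nat \<Rightarrow> nat \<Rightarrow> real \<times> real" where
  "grid_point a b N m n = (a + (real m + b) / real N, a + (real n + b) / real N)"

definition grid_index :: "nat \<Rightarrow> (nat \<times> nat) set" where
  "grid_index N = {(m, n). m < N \<and> n < N \<and> m > n}"

definition freq_index :: "int \<Rightarrow> (int \<times> int) set" where
  "freq_index M = {(k, l). k \<in> {-M..M} \<and> l \<in> {-M..M} \<and> k > l}"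

definition tau :: "real \<Rightarrow> real \<Rightarrow> nat \<Rightarrow> complex" where
  "tau a b N = exp (2 * complex_of_real pi * \<i> * complex_of_real (real N * a + b))"

definition gfac :: "int \<Rightarrow> int \<Rightarrow> complex" where
  "gfac k M = (if k = - M \<or> k = M then 1 / 2 else 1)"

text \<open>A coefficient family is a total function of two integers; only its values on
  \<open>freq_index M\<close> are ever used.\<close>

definition anti_poly :: "int \<Rightarrow> (int \<Rightarrow> int \<Rightarrow> complex) \<Rightarrow> real \<times> real \<Rightarrow> complex" where
  "anti_poly M c = (\<lambda>p. \<Sum>(k, l)\<in>freq_index M. c k l * anti_exp k l p)"

definition admissible ::
    "real \<Rightarrow> real \<Rightarrow> nat \<Rightarrow> int \<Rightarrow> (int \<Rightarrow> int \<Rightarrow> complex) \<Rightarrow> bool" where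
  "admissible a b N M c \<longleftrightarrow>
     (int N = 2 * M \<longrightarrow>
       (\<forall>l\<in>{- M + 1..M - 1}. c l (- M) = - tau a b N * c M l) \<and> c M (- M) = 0)"

definition is_anti_interpolation ::
    "real \<Rightarrow> real \<Rightarrow> nat \<Rightarrow> int \<Rightarrow> (real \<times> real \<Rightarrow> complex) \<Rightarrow>
     (int \<Rightarrow> int \<Rightarrow> complex) \<Rightarrow> (real \<times> real \<Rightarrow> complex) \<Rightarrow> bool" where
  "is_anti_interpolation a b N M f c \<psi> \<longleftrightarrow>
     admissible a b N M c \<and>
     \<psi> = anti_poly M c \<and>
     (\<forall>(m, n)\<in>grid_index N. \<psi> (grid_point a b N m n) = f (grid_point a b N m n))"

text \<open>The interpolation nodes lie in the domain of the interpolated function.\<close>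

lemma grid_point_in_anti_triangle:
  assumes "b \<in> {0..1}" and "(m, n) \<in> grid_index N"
  shows "grid_point a b N m n \<in> anti_triangle a"
proof -
  have N: "real N > 0" and mn: "real n < real m" "real m + 1 \<le> real N"
    using assms(2) by (auto simp: grid_index_def)
  show ?thesis
    using assms(1) N mn
    by (auto simp: grid_point_def anti_triangle_def divide_strict_right_mono)
qed

end

theory Submission
  imports Defs
begin

text \<open>
  On the grid the exponentials with \<open>N\<close> consecutive frequencies form an \<open>N \<times> N\<close> matrix whose
  rows and columns are both orthogonal, with squared norm \<open>N\<close>.  The functions \<open>anti_exp k l\<close> are
  its \<open>2 \<times> 2\<close> minors, so by the Cauchy--Binet identity the matrix of minors also has orthogonal
  rows and columns, now with squared norm \<open>N\<^sup>2\<close>, and such a system is solved by multiplying with the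
  conjugate transpose.  For \<open>N = 2 * M\<close> the frequencies \<open>- M\<close> and \<open>M\<close> agree on the grid up to the
  factor \<open>\<tau>\<^sub>N\<close>; the extra conditions on the coefficients make the terms \<open>(l, - M)\<close> and
  \<open>(M, l)\<close> equal there, which leaves the \<open>N\<close> consecutive frequencies \<open>- M + 1, \<dots>, M\<close> and
  accounts for the factors \<open>1 / 2\<close>.
\<close>

section \<open>Minors of matrices with orthogonal rows\<close>

definition decr_pairs :: "'a::linorder set \<Rightarrow> ('a \<times> 'a) set" where
  "decr_pairs A = {(x, y). x \<in> A \<and> y \<in> A \<and> y < x}"

lemma finite_decr_pairs: "finite A \<Longrightarrow> finite (decr_pairs A)"
  by (rule finite_subset[of _ "A \<times> A"]) (auto simp: decr_pairs_def)

text \<open>The square \<open>A \<times> A\<close> splits into the decreasing pairs, their mirror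
  images and the diagonal.\<close>

lemma sum_sum_eq_double_decr_pairs:
  fixes h :: "'a::linorder \<Rightarrow> 'a \<Rightarrow> complex"
  assumes "finite A" "\<And>x y. h x y = h y x" "\<And>x. h x x = 0"
  shows "(\<Sum>x\<in>A. \<Sum>y\<in>A. h x y) = 2 * (\<Sum>(x, y)\<in>decr_pairs A. h x y)"
proof -
  let ?D = "decr_pairs A" and ?E = "(\<lambda>x. (x, x)) ` A"
  have split: "A \<times> A = (?D \<union> prod.swap ` ?D) \<union> ?E"
    by (auto simp: decr_pairs_def image_iff)
  have fin: "finite ?D" "finite (prod.swap ` ?D)" "finite ?E"
    using assms(1) by (auto intro: finite_decr_pairs)
  have "(\<Sum>x\<in>A. \<Sum>y\<in>A. h x y) = (\<Sum>(x, y)\<in>A \<times> A. h x y)"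
    by (rule sum.cartesian_product)
  also have "\<dots> = (\<Sum>(x, y)\<in>?D. h x y) + (\<Sum>(x, y)\<in>prod.swap ` ?D. h x y) + (\<Sum>(x, y)\<in>?E. h x y)"
    unfolding split using fin
    by (subst sum.union_disjoint; (subst sum.union_disjoint)?) (auto simp: decr_pairs_def)
  also have "(\<Sum>(x, y)\<in>?E. h x y) = 0"
    by (rule sum.neutral) (auto simp: assms(3))
  also have "(\<Sum>(x, y)\<in>prod.swap ` ?D. h x y) = (\<Sum>(x, y)\<in>?D. h x y)"
    by (subst sum.reindex) (auto simp: case_prod_unfold inj_on_def assms(2) intro!: sum.cong)
  finally show ?thesis by simp
qed

definition minor2 :: "('a \<Rightarrow> 'b \<Rightarrow> complex) \<Rightarrow> 'a \<times> 'a \<Rightarrow> 'b \<times> 'b \<Rightarrow> complex" where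
  "minor2 e = (\<lambda>(k, l) (m, n). e k m * e l n - e k n * e l m)"

text \<open>Lets \<open>minor2_orthogonal\<close>, which speaks of rows, be applied to columns as
  well.\<close>

lemma minor2_transpose: "minor2 (\<lambda>m k. e k m) q p = minor2 e p q"
  by (simp add: minor2_def case_prod_unfold algebra_simps)

lemma minor2_orthogonal:
  fixes e :: "'a::linorder \<Rightarrow> 'b::linorder \<Rightarrow> complex"
  assumes "finite I"
    and orth: "\<And>k k'. k \<in> J \<Longrightarrow> k' \<in> J \<Longrightarrow>
      (\<Sum>m\<in>I. e k m * cnj (e k' m)) = (if k = k' then s else 0)"
    and "p \<in> decr_pairs J" "p' \<in> decr_pairs J"
  shows "(\<Sum>q\<in>decr_pairs I. minor2 e p q * cnj (minor2 e p' q)) = (if p = p' then s\<^sup>2 else 0)"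
proof -
  obtain k l k' l' where p: "p = (k, l)" "p' = (k', l')" by (metis surj_pair)
  have J: "k \<in> J" "l \<in> J" "k' \<in> J" "l' \<in> J" "l < k" "l' < k'"
    using assms(3,4) by (auto simp: p decr_pairs_def)
  let ?h = "\<lambda>m n. minor2 e p (m, n) * cnj (minor2 e p' (m, n))"
  define S where "S = (\<lambda>k k'. \<Sum>m\<in>I. e k m * cnj (e k' m))"
  \<comment> \<open>Swapping \<open>m\<close> and \<open>n\<close> changes the sign of both minors,
    so their product is symmetric and vanishes on the diagonal.\<close>
  have "2 * (\<Sum>q\<in>decr_pairs I. minor2 e p q * cnj (minor2 e p' q)) = (\<Sum>m\<in>I. \<Sum>n\<in>I. ?h m n)"
    by (subst sum_sum_eq_double_decr_pairs[OF assms(1)])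
      (auto simp: p minor2_def algebra_simps intro!: sum.cong)
  also have "\<dots> = (\<Sum>m\<in>I. \<Sum>n\<in>I.
      (e k m * cnj (e k' m)) * (e l n * cnj (e l' n)) - (e k m * cnj (e l' m)) * (e l n * cnj (e k' n))
      - (e l m * cnj (e k' m)) * (e k n * cnj (e l' n)) + (e l m * cnj (e l' m)) * (e k n * cnj (e k' n)))"
    by (simp add: p minor2_def algebra_simps)
  also have "\<dots> = S k k' * S l l' - S k l' * S l k' - S l k' * S k l' + S l l' * S k k'"
    unfolding S_def sum_product by (simp add: sum.distrib sum_subtractf)
  \<comment> \<open>A nonzero \<open>S k l' * S l k'\<close> would force
    \<open>k = l' < k' = l < k\<close>, so only the products \<open>S k k' * S l l'\<close>
    survive.\<close>
  also have "\<dots> = 2 * (if p = p' then s\<^sup>2 else 0)"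
    using J unfolding S_def by (auto simp: orth p power2_eq_square)
  finally show ?thesis by simp
qed

text \<open>The row relations force the solution, by pairing the system with a conjugated row; the
  column relations show that the forced values do solve it.\<close>

lemma orthogonal_system_solution:
  fixes A :: "'p \<Rightarrow> 'q \<Rightarrow> complex"
  assumes "finite P" "finite Q" "s \<noteq> 0"
    and rows: "\<And>p p'. p \<in> P \<Longrightarrow> p' \<in> P \<Longrightarrow>
      (\<Sum>q\<in>Q. A p q * cnj (A p' q)) = (if p = p' then s else 0)"
    and cols: "\<And>q q'. q \<in> Q \<Longrightarrow> q' \<in> Q \<Longrightarrow>
      (\<Sum>p\<in>P. A p q * cnj (A p q')) = (if q = q' then s else 0)"
  shows "(\<forall>q\<in>Q. (\<Sum>p\<in>P. d p * A p q) = f q) \<longleftrightarrow>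
         (\<forall>p\<in>P. d p = (\<Sum>q\<in>Q. f q * cnj (A p q)) / s)"
proof (intro iffI ballI)
  fix p' assume sys: "\<forall>q\<in>Q. (\<Sum>p\<in>P. d p * A p q) = f q" and p': "p' \<in> P"
  have "f q * cnj (A p' q) = (\<Sum>p\<in>P. d p * (A p q * cnj (A p' q)))" if "q \<in> Q" for q
    using bspec[OF sys that, symmetric] by (simp add: sum_distrib_right mult.assoc)
  then have "(\<Sum>q\<in>Q. f q * cnj (A p' q)) = (\<Sum>q\<in>Q. \<Sum>p\<in>P. d p * (A p q * cnj (A p' q)))"
    by (rule sum.cong[OF refl])
  also have "\<dots> = (\<Sum>p\<in>P. d p * (\<Sum>q\<in>Q. A p q * cnj (A p' q)))"
    by (subst sum.swap) (simp add: sum_distrib_left)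
  also have "\<dots> = (\<Sum>p\<in>P. if p = p' then d p * s else 0)"
    by (rule sum.cong) (auto simp: rows p')
  also have "\<dots> = d p' * s"
    using assms(1) p' by simp
  finally show "d p' = (\<Sum>q\<in>Q. f q * cnj (A p' q)) / s"
    using assms(3) by simp
next
  fix q' assume sol: "\<forall>p\<in>P. d p = (\<Sum>q\<in>Q. f q * cnj (A p q)) / s" and q': "q' \<in> Q"
  have "s * (d p * A p q') = (\<Sum>q\<in>Q. f q * (A p q' * cnj (A p q)))" if "p \<in> P" for p
  proof -
    have "s * d p = (\<Sum>q\<in>Q. f q * cnj (A p q))"
      using bspec[OF sol that] assms(3) by simp
    then have "s * (d p * A p q') = (\<Sum>q\<in>Q. f q * cnj (A p q)) * A p q'"
      by (simp only: mult.assoc[symmetric])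
    also have "\<dots> = (\<Sum>q\<in>Q. f q * (A p q' * cnj (A p q)))"
      unfolding sum_distrib_right by (simp add: mult_ac)
    finally show ?thesis .
  qed
  then have "s * (\<Sum>p\<in>P. d p * A p q') = (\<Sum>p\<in>P. \<Sum>q\<in>Q. f q * (A p q' * cnj (A p q)))"
    by (simp add: sum_distrib_left)
  also have "\<dots> = (\<Sum>q\<in>Q. f q * (\<Sum>p\<in>P. A p q' * cnj (A p q)))"
    by (subst sum.swap) (simp add: sum_distrib_left)
  also have "\<dots> = (\<Sum>q\<in>Q. if q = q' then f q * s else 0)"
    by (rule sum.cong) (auto simp: cols q')
  also have "\<dots> = s * f q'"
    using assms(2) q' by simp
  finally show "(\<Sum>p\<in>P. d p * A p q') = f q'"
    using assms(3) by simp
qed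

section \<open>Discrete orthogonality of exponentials\<close>

definition char1 :: "real \<Rightarrow> complex" where
  "char1 t = exp (2 * complex_of_real pi * \<i> * complex_of_real t)"

lemma char1_add: "char1 (s + t) = char1 s * char1 t"
  by (simp add: char1_def ring_distribs exp_add)

lemma cnj_char1: "cnj (char1 t) = char1 (- t)"
  by (simp add: char1_def exp_cnj)

lemma char1_mult_nat: "char1 (real n * t) = char1 t ^ n"
  unfolding char1_def exp_of_nat_mult[symmetric] by (simp add: algebra_simps)

lemma char1_eq_1_iff: "char1 t = 1 \<longleftrightarrow> t \<in> \<int>"
  by (auto simp: char1_def exp_eq_1 Ints_def)

text \<open>A geometric sum whose ratio is an \<open>N\<close>-th root of unity; the bound on
  \<open>d\<close> makes this ratio equal to 1 only for \<open>d = 0\<close>.\<close>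

lemma sum_char1_multiples:
  fixes d :: int
  assumes "\<bar>d\<bar> < int N"
  shows "(\<Sum>j<N. char1 (real j * (of_int d / real N))) = (if d = 0 then of_nat N else 0)"
proof (cases "d = 0")
  case True
  then show ?thesis by (simp add: char1_def)
next
  case False
  have N: "real N > 0" using assms by auto
  have ne: "char1 (of_int d / real N) \<noteq> 1"
  proof
    assume "char1 (of_int d / real N) = 1"
    then obtain z :: int where "of_int d / real N = of_int z"
      by (auto simp: char1_eq_1_iff elim: Ints_cases)
    then have "real_of_int d = of_int (z * int N)" using N by (simp add: field_simps)
    then have "d = z * int N" by (simp only: of_int_eq_iff)
    then have "int N dvd d" by simp
    then show False using False assms zdvd_not_zless zdvd_imp_le
      by (metis abs_of_nat dvd_imp_le_int linorder_not_le)
  qed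
  have "char1 (of_int d / real N) ^ N = 1"
    using N by (simp add: char1_mult_nat[symmetric] char1_eq_1_iff)
  with ne False show ?thesis
    by (simp only: char1_mult_nat geometric_sum[OF ne]) simp
qed

definition grid_exp :: "real \<Rightarrow> real \<Rightarrow> nat \<Rightarrow> int \<Rightarrow> nat \<Rightarrow> complex" where
  "grid_exp a b N k m = char1 (of_int k * (a + (real m + b) / real N))"

lemma anti_exp_grid_point:
  "anti_exp k l (grid_point a b N m n) = minor2 (grid_exp a b N) (k, l) (m, n)"
  by (simp add: anti_exp_def grid_point_def minor2_def grid_exp_def char1_def exp_add[symmetric]
      ring_distribs)

text \<open>Up to a phase free of \<open>m\<close>, this is the geometric sum for
  \<open>d = k - k'\<close>; the phase is 1 when \<open>k = k'\<close>.\<close>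

lemma grid_exp_orthogonal_nodes:
  assumes "\<bar>k - k'\<bar> < int N"
  shows "(\<Sum>m\<in>{..<N}. grid_exp a b N k m * cnj (grid_exp a b N k' m)) =
         (if k = k' then of_nat N else 0)"
proof -
  have "grid_exp a b N k m * cnj (grid_exp a b N k' m) =
      char1 (of_int (k - k') * (a + b / real N)) * char1 (real m * (of_int (k - k') / real N))" for m
    unfolding grid_exp_def cnj_char1 char1_add[symmetric]
    by (rule arg_cong[of _ _ char1]) (simp add: algebra_simps add_divide_distrib diff_divide_distrib)
  then have "(\<Sum>m\<in>{..<N}. grid_exp a b N k m * cnj (grid_exp a b N k' m)) =
      char1 (of_int (k - k') * (a + b / real N)) * (if k - k' = 0 then of_nat N else 0)"
    by (simp only: sum_distrib_left[symmetric] sum_char1_multiples[OF assms])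
  then show ?thesis
    by (simp add: char1_def)
qed

text \<open>The offsets \<open>a\<close> and \<open>b\<close> cancel, and counting the frequencies
  down from \<open>M\<close> gives the geometric sum for \<open>d = m' - m\<close>.\<close>

lemma grid_exp_orthogonal_freqs:
  assumes "m < N" "m' < N"
  shows "(\<Sum>k\<in>{M - int N + 1..M}. grid_exp a b N k m * cnj (grid_exp a b N k m')) =
         (if m = m' then of_nat N else 0)"
proof -
  define d where "d = int m' - int m"
  have d: "\<bar>d\<bar> < int N" "d = 0 \<longleftrightarrow> m = m'" using assms by (auto simp: d_def)
  have summand: "grid_exp a b N (M - int j) m * cnj (grid_exp a b N (M - int j) m') =
      char1 (- of_int M * (of_int d / real N)) * char1 (real j * (of_int d / real N))" for j
    unfolding grid_exp_def cnj_char1 char1_add[symmetric]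
    by (rule arg_cong[of _ _ char1])
      (simp add: d_def algebra_simps add_divide_distrib diff_divide_distrib)
  have "(\<Sum>k\<in>{M - int N + 1..M}. grid_exp a b N k m * cnj (grid_exp a b N k m')) =
      (\<Sum>j<N. grid_exp a b N (M - int j) m * cnj (grid_exp a b N (M - int j) m'))"
    by (rule sum.reindex_bij_witness[of _ "\<lambda>j. M - int j" "\<lambda>k. nat (M - k)"]) auto
  also have "\<dots> = char1 (- of_int M * (of_int d / real N)) * (if d = 0 then of_nat N else 0)"
    unfolding summand by (simp only: sum_distrib_left[symmetric] sum_char1_multiples[OF d(1)])
  finally show ?thesis
    using d(2) by (auto simp: char1_def)
qed

text \<open>The frequencies differ by \<open>N\<close>, and
  \<open>N * (a + (m + b) / N) = N * a + b + m\<close>, where the integer \<open>m\<close>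
  contributes the factor 1.\<close>

lemma grid_exp_M:
  assumes "int N = 2 * M" "N > 0"
  shows "grid_exp a b N M m = tau a b N * grid_exp a b N (- M) m"
proof -
  have N: "real N = 2 * of_int M" using assms(1) by (metis of_int_mult of_int_numeral of_int_of_nat_eq)
  have M: "real_of_int M > 0" using assms by auto
  have t: "tau a b N = char1 (real N * a + b)" by (simp add: tau_def char1_def)
  have "of_int M * (a + (real m + b) / real N) =
      real N * a + b + of_int (- M) * (a + (real m + b) / real N) + real m"
    using M by (simp add: N field_simps)
  moreover have "char1 (real m) = 1" by (simp add: char1_eq_1_iff)
  ultimately show ?thesis
    by (simp only: grid_exp_def t char1_add mult_1_right)
qed

section \<open>Interpolation on the grid\<close>

lemma grid_index_eq: "grid_index N = decr_pairs {..<N}"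
  by (auto simp: grid_index_def decr_pairs_def)

lemma freq_index_eq: "freq_index M = decr_pairs {- M..M}"
  by (auto simp: freq_index_def decr_pairs_def)

text \<open>Merges the two parities of \<open>N\<close>, so that one coefficient formula serves
  both.\<close>

definition weight :: "nat \<Rightarrow> int \<Rightarrow> int \<Rightarrow> complex" where
  "weight N M k = (if int N = 2 * M then gfac k M else 1)"

lemma weight_neq_0: "weight N M k \<noteq> 0"
  by (simp add: weight_def gfac_def)

definition interp_coeff ::
    "real \<Rightarrow> real \<Rightarrow> nat \<Rightarrow> int \<Rightarrow> (real \<times> real \<Rightarrow> complex) \<Rightarrow> int \<Rightarrow> int \<Rightarrow> complex" where
  "interp_coeff a b N M f k l = weight N M k * weight N M l / (of_nat N)\<^sup>2 *
     (\<Sum>(m, n)\<in>grid_index N.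
       f (grid_point a b N m n) * cnj (anti_exp k l (grid_point a b N m n)))"

text \<open>Replacing \<open>M\<close> by \<open>- M\<close> costs the factor \<open>tau\<close>;
  restoring the decreasing order of the two frequencies costs the sign.\<close>

lemma anti_exp_grid_fold:
  assumes "int N = 2 * M" "N > 0"
  shows "anti_exp M l (grid_point a b N m n) =
    - tau a b N * anti_exp l (- M) (grid_point a b N m n)"
  by (simp add: anti_exp_grid_point minor2_def grid_exp_M[OF assms] algebra_simps)

lemma anti_poly_grid_fold:
  assumes "int N = 2 * M" "N > 0" "admissible a b N M c"
  shows "anti_poly M c (grid_point a b N m n) =
    (\<Sum>(k, l)\<in>decr_pairs {- M + 1..M}.
       c k l / (gfac k M * gfac l M) * anti_exp k l (grid_point a b N m n))"
proof -
  let ?E = "\<lambda>k l. anti_exp k l (grid_point a b N m n)"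
  let ?A = "decr_pairs {- M + 1..M - 1}" and ?L = "{- M + 1..M - 1}"
  have M: "M \<ge> 1" using assms(1,2) by auto
  have adm: "c M (- M) = 0" "l \<in> ?L \<Longrightarrow> c l (- M) = - tau a b N * c M l" for l
    using assms(1,3) by (auto simp: admissible_def)
  have fin: "finite ?A" by (simp add: finite_decr_pairs)
  have inj: "inj_on (\<lambda>l. (M, l)) ?L" "inj_on (\<lambda>l. (l, - M)) ?L" by (auto simp: inj_on_def)
  \<comment> \<open>The corner, the interior pairs, the edge with first entry \<open>M\<close> and
    the edge with second entry \<open>- M\<close>.\<close>
  have freq: "freq_index M = insert (M, - M) (?A \<union> Pair M ` ?L \<union> (\<lambda>l. (l, - M)) ` ?L)"
    using M by (auto simp: freq_index_def decr_pairs_def image_iff)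
  have half: "decr_pairs {- M + 1..M} = ?A \<union> Pair M ` ?L"
    using M by (auto simp: decr_pairs_def image_iff)
  have "anti_poly M c (grid_point a b N m n) =
      (\<Sum>(k, l)\<in>?A. c k l * ?E k l) + (\<Sum>l\<in>?L. c M l * ?E M l) + (\<Sum>l\<in>?L. c l (- M) * ?E l (- M))"
    unfolding anti_poly_def freq
    apply (subst sum.insert)
    using M fin
      apply (auto simp: decr_pairs_def)[2]
    apply (subst sum.union_disjoint)
    using M fin
       apply (auto simp: decr_pairs_def)[3]
    apply (subst sum.union_disjoint)
    using M fin
       apply (auto simp: decr_pairs_def)[3]
    using inj by (simp add: sum.reindex adm(1))
  \<comment> \<open>The factor \<open>- tau\<close> supplied by admissibility is exactly the one
    absorbed by \<open>anti_exp_grid_fold\<close>.\<close>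
  also have "(\<Sum>l\<in>?L. c l (- M) * ?E l (- M)) = (\<Sum>l\<in>?L. c M l * ?E M l)"
    by (rule sum.cong) (auto simp: adm(2) anti_exp_grid_fold[OF assms(1,2)])
  also have "(\<Sum>(k, l)\<in>?A. c k l * ?E k l) + (\<Sum>l\<in>?L. c M l * ?E M l) + (\<Sum>l\<in>?L. c M l * ?E M l) =
      (\<Sum>(k, l)\<in>?A. c k l / (gfac k M * gfac l M) * ?E k l) +
      (\<Sum>l\<in>?L. c M l / (gfac M M * gfac l M) * ?E M l)"
    unfolding add.assoc sum.distrib[symmetric]
    \<comment> \<open>Doubling the edge term is division by \<open>gfac M M = 1 / 2\<close>; every
      other frequency here has factor 1.\<close>
    by (intro arg_cong2[of _ _ _ _ "(+)"] sum.cong) (auto simp: gfac_def decr_pairs_def)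
  also have "\<dots> = (\<Sum>(k, l)\<in>decr_pairs {- M + 1..M}. c k l / (gfac k M * gfac l M) * ?E k l)"
    unfolding half using fin inj
    by (subst sum.union_disjoint) (auto simp: decr_pairs_def sum.reindex)
  finally show ?thesis .
qed

text \<open>The range starts at \<open>- M\<close> for odd \<open>N\<close> and at
  \<open>- M + 1\<close> for even \<open>N\<close>, so it always holds \<open>N\<close> consecutive
  frequencies.\<close>

lemma anti_poly_grid:
  assumes "N > 0" "int N = 2 * M + 1 \<or> int N = 2 * M" "admissible a b N M c"
  shows "anti_poly M c (grid_point a b N m n) =
    (\<Sum>(k, l)\<in>decr_pairs {M - int N + 1..M}.
       c k l / (weight N M k * weight N M l) * anti_exp k l (grid_point a b N m n))"
proof (cases "int N = 2 * M")
  case True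
  have "M - int N + 1 = - M + 1" using True by simp
  then show ?thesis
    using anti_poly_grid_fold[OF True assms(1,3)] True by (simp add: weight_def)
next
  case False
  then have J: "M - int N + 1 = - M" using assms(2) by simp
  show ?thesis
    unfolding J using False by (simp add: weight_def anti_poly_def freq_index_eq)
qed

lemma interpolates_iff:
  assumes "N > 0" "int N = 2 * M + 1 \<or> int N = 2 * M" "admissible a b N M c"
  shows "(\<forall>(m, n)\<in>grid_index N. anti_poly M c (grid_point a b N m n) = f (grid_point a b N m n)) \<longleftrightarrow>
    (\<forall>(k, l)\<in>decr_pairs {M - int N + 1..M}. c k l = interp_coeff a b N M f k l)"
proof -
  let ?J = "{M - int N + 1..M}" and ?e = "grid_exp a b N"
  have rows: "(\<Sum>q\<in>decr_pairs {..<N}. minor2 ?e p q * cnj (minor2 ?e p' q)) =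
      (if p = p' then (of_nat N)\<^sup>2 else 0)" if "p \<in> decr_pairs ?J" "p' \<in> decr_pairs ?J" for p p'
    by (rule minor2_orthogonal[OF _ grid_exp_orthogonal_nodes that]) auto
  have cols: "(\<Sum>p\<in>decr_pairs ?J. minor2 ?e p q * cnj (minor2 ?e p q')) =
      (if q = q' then (of_nat N)\<^sup>2 else 0)"
    if "q \<in> decr_pairs {..<N}" "q' \<in> decr_pairs {..<N}" for q q'
    unfolding minor2_transpose[of ?e, symmetric]
    by (rule minor2_orthogonal[OF _ grid_exp_orthogonal_freqs that]) auto
  \<comment> \<open>The unknowns of the linear system are the coefficients divided by their
    weights.\<close>
  have "(\<forall>(m, n)\<in>grid_index N. anti_poly M c (grid_point a b N m n) = f (grid_point a b N m n)) \<longleftrightarrow>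
      (\<forall>q\<in>decr_pairs {..<N}. (\<Sum>p\<in>decr_pairs ?J.
         (c (fst p) (snd p) / (weight N M (fst p) * weight N M (snd p))) * minor2 ?e p q) =
         f (grid_point a b N (fst q) (snd q)))"
    by (simp add: anti_poly_grid[OF assms] anti_exp_grid_point grid_index_eq case_prod_unfold)
  also have "\<dots> \<longleftrightarrow> (\<forall>p\<in>decr_pairs ?J. c (fst p) (snd p) / (weight N M (fst p) * weight N M (snd p)) =
      (\<Sum>q\<in>decr_pairs {..<N}. f (grid_point a b N (fst q) (snd q)) * cnj (minor2 ?e p q)) / (of_nat N)\<^sup>2)"
    using assms(1) by (intro orthogonal_system_solution rows cols finite_decr_pairs) auto
  also have "\<dots> \<longleftrightarrow> (\<forall>(k, l)\<in>decr_pairs ?J. c k l = interp_coeff a b N M f k l)"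
    by (simp add: interp_coeff_def anti_exp_grid_point grid_index_eq case_prod_unfold
        divide_eq_eq weight_neq_0 mult_ac)
  finally show ?thesis .
qed

section \<open>From the reduced frequency range back to all of \<open>freq_index M\<close>\<close>

lemma admissible_interp_coeff:
  assumes "N > 0"
  shows "admissible a b N M (interp_coeff a b N M f)"
  unfolding admissible_def
proof (intro impI conjI ballI)
  assume N: "int N = 2 * M"
  have "cnj (tau a b N) * tau a b N = 1"
    unfolding tau_def char1_def[symmetric] cnj_char1 char1_add[symmetric] by (simp add: char1_def)
  \<comment> \<open>Conjugating the fold relation puts \<open>cnj (tau a b N)\<close> on the other
    side; as \<open>tau\<close> has modulus 1, it can be inverted to this form.\<close>
  then have E: "cnj (anti_exp l (- M) (grid_point a b N m n)) =
      - tau a b N * cnj (anti_exp M l (grid_point a b N m n))" for l m n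
    by (simp add: anti_exp_grid_fold[OF N assms] algebra_simps)
  show "interp_coeff a b N M f l (- M) = - tau a b N * interp_coeff a b N M f M l" for l
    by (simp add: interp_coeff_def E sum_distrib_left case_prod_unfold weight_def gfac_def mult_ac)
  \<comment> \<open>The two rows of this minor are proportional on the grid.\<close>
  have "anti_exp M (- M) (grid_point a b N m n) = 0" for m n
    by (simp add: anti_exp_grid_point minor2_def grid_exp_M[OF N assms] algebra_simps)
  then show "interp_coeff a b N M f M (- M) = 0"
    by (simp add: interp_coeff_def)
qed

text \<open>For even \<open>N\<close> the reduced range misses only the pairs
  \<open>(k, - M)\<close>; admissibility recovers their coefficients from those at
  \<open>(M, k)\<close>, or sets them to 0 when \<open>k = M\<close>.\<close>

lemma admissible_eqI:
  assumes "N > 0" "int N = 2 * M + 1 \<or> int N = 2 * M"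
    and "admissible a b N M c" "admissible a b N M c'"
    and eq: "\<forall>(k, l)\<in>decr_pairs {M - int N + 1..M}. c k l = c' k l"
  shows "\<forall>(k, l)\<in>freq_index M. c k l = c' k l"
proof (cases "int N = 2 * M")
  case True
  have J: "M - int N + 1 = - M + 1" using True by simp
  have "c k l = c' k l" if kl: "-M \<le> l" "l < k" "k \<le> M" for k l
  proof -
    consider "l > - M" | "l = - M" "k = M" | "l = - M" "k < M" using kl by linarith
    then show ?thesis
    proof cases
      case 1
      then show ?thesis using eq kl by (auto simp: J decr_pairs_def)
    next
      case 2
      then show ?thesis using assms(3,4) True by (simp add: admissible_def)
    next
      case 3
      then have "c M k = c' M k" using eq kl by (auto simp: J decr_pairs_def)
      then show ?thesis using assms(3,4) True 3 kl by (simp add: admissible_def)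
    qed
  qed
  then show ?thesis by (auto simp: freq_index_def)
next
  case False
  then have J: "M - int N + 1 = - M" using assms(2) by simp
  show ?thesis using eq unfolding J freq_index_eq .
qed

text \<open>For \<open>N = 2 * M\<close> positivity of \<open>N\<close> gives
  \<open>- M < M\<close>, so every pair occurring in the conditions lies in
  \<open>freq_index M\<close>.\<close>

lemma admissible_cong:
  assumes "N > 0" "\<forall>(k, l)\<in>freq_index M. c k l = c' k l" "admissible a b N M c'"
  shows "admissible a b N M c"
  using assms by (auto simp: admissible_def freq_index_def)

text \<open>Existence, uniqueness and the coefficient formulas can all be read off from this
  description.\<close>

lemma is_anti_interpolation_iff:
  assumes "N > 0" "int N = 2 * M + 1 \<or> int N = 2 * M"
  shows "is_anti_interpolation a b N M f c \<psi> \<longleftrightarrow>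
    \<psi> = anti_poly M c \<and> (\<forall>(k, l)\<in>freq_index M. c k l = interp_coeff a b N M f k l)"
proof -
  let ?C = "interp_coeff a b N M f"
  have "decr_pairs {M - int N + 1..M} \<subseteq> freq_index M"
    using assms(2) by (auto simp: freq_index_def decr_pairs_def)
  then have "admissible a b N M c \<and> (\<forall>(k, l)\<in>decr_pairs {M - int N + 1..M}. c k l = ?C k l) \<longleftrightarrow>
      (\<forall>(k, l)\<in>freq_index M. c k l = ?C k l)"
    using admissible_eqI[OF assms _ admissible_interp_coeff[OF assms(1)]]
      admissible_cong[OF assms(1) _ admissible_interp_coeff[OF assms(1)]] by blast
  then show ?thesis
    using interpolates_iff[OF assms, of a b c f] unfolding is_anti_interpolation_def by blast
qed

theorem proposition3p1:
  fixes a b :: real and N :: nat and M :: int and f :: "real \<times> real \<Rightarrow> complex"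
  assumes "b \<in> {0..1}"
    and "N > 0"
    and "int N = 2 * M + 1 \<or> int N = 2 * M"
    and "f \<in> anti_triangle a \<rightarrow>\<^sub>E UNIV"
  shows "(\<exists>!\<psi>. \<exists>c. is_anti_interpolation a b N M f c \<psi>) \<and>
    (\<forall>\<psi> c. is_anti_interpolation a b N M f c \<psi> \<longrightarrow>
      (\<forall>(k, l)\<in>freq_index M.
        (int N = 2 * M + 1 \<longrightarrow>
          c k l = 1 / (of_nat N)\<^sup>2 *
            (\<Sum>(m, n)\<in>grid_index N.
              f (grid_point a b N m n) * cnj (anti_exp k l (grid_point a b N m n)))) \<and>
        (int N = 2 * M \<longrightarrow>
          c k l = gfac k M * gfac l M / (of_nat N)\<^sup>2 *
            (\<Sum>(m, n)\<in>grid_index N.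
              f (grid_point a b N m n) * cnj (anti_exp k l (grid_point a b N m n))))))"
proof -
  let ?C = "interp_coeff a b N M f"
  note iff = is_anti_interpolation_iff[OF assms(2,3)]
  \<comment> \<open>Two families may differ outside \<open>freq_index M\<close>, but
    \<open>anti_poly M\<close> sees only their values on it.\<close>
  have "\<psi> = anti_poly M ?C" if "is_anti_interpolation a b N M f c \<psi>" for \<psi> c
    using that unfolding iff anti_poly_def by (auto intro!: sum.cong ext)
  moreover have "is_anti_interpolation a b N M f ?C (anti_poly M ?C)"
    by (auto simp: iff)
  ultimately have "\<exists>!\<psi>. \<exists>c. is_anti_interpolation a b N M f c \<psi>"
    by blast
  then show ?thesis
    by (auto simp: iff interp_coeff_def weight_def)
qed

end
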